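(* For every integer $r \geq 1$ and every real $\varepsilon$ with $0 < \varepsilon < 1/(20r^2)$ there is a constant $c_0(r,\varepsilon)$, depending only on $r$ and $\varepsilon$, with the following property. If $p_1,\dots,p_r \geq c_0(r,\varepsilon)$ are distinct primes, then there are infinitely many positive integers $n$ such that for every $i=1,\dots,r$, $$\nu_{p_i}\!\left(\binom{2n}{n}\right) \leq \frac{\varepsilon \log n}{\log p_i}.$$
   Context: For a prime $p$ and a nonzero integer $x$, $\nu_p(x)$ denotes the exponent of the largest power of $p$ dividing $x$. *)

theory Defs
  imports Complex_Main "HOL-Computational_Algebra.Primes"
begin

end

(*
  By Kummer, the exponent of p in (2n choose n) counts the j >= 1 with p^j <= 2 (n mod p^j), i.e. the
  j for which the fractional part of n/p^j is at least 1/2. If a finite set of moduli is lacunary with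
  ratio 5, nested intervals (from the largest modulus down) give an n in [L, 3L] for which all these
  fractional parts are below 1/2. The powers p_i^j <= L become lacunary once those within a factor 5
  of a power of another p_i' are discarded. Since ln p_i / ln p_i' is irrational, Kronecker's theorem
  shows that the discarded j have upper density O(r / ln (min p_i)), which is small for large primes.
*)
theory Submission
  imports Defs "HOL-Analysis.Kronecker_Approximation_Theorem"
begin

section \<open>Kummer's theorem for central binomial coefficients\<close>

text \<open>Legendre's formula: passing from \<open>m\<close> to \<open>Suc m\<close> raises
  \<open>m div p ^ j\<close> by one exactly when \<open>p ^ j\<close> divides \<open>Suc m\<close>,
  which happens for \<open>multiplicity p (Suc m)\<close> positive \<open>j\<close>. The free cutoff
  \<open>N\<close> lets \<open>n\<close> and \<open>2 * n\<close> share one range of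
  summation.\<close>

lemma multiplicity_fact_eq_sum_div:
  fixes p m N :: nat
  assumes "prime p" "m \<le> N"
  shows "multiplicity p (fact m :: nat) = (\<Sum>j\<in>{1..N}. m div p ^ j)"
  using assms(2)
proof (induction m)
  case 0
  then show ?case by simp
next
  case (Suc m)
  have p: "p > 1" using assms(1) prime_gt_1_nat by blast
  have mult: "multiplicity p (Suc m) \<le> N"
  proof -
    have "multiplicity p (Suc m) < p ^ multiplicity p (Suc m)"
      using power_gt_expt[of p "multiplicity p (Suc m)"] p by simp
    also have "\<dots> \<le> Suc m"
      by (intro dvd_imp_le multiplicity_dvd) auto
    finally show ?thesis using Suc.prems by simp
  qed
  have "(\<Sum>j\<in>{1..N}. Suc m div p ^ j) = (\<Sum>j\<in>{1..N}. m div p ^ j + (if p ^ j dvd Suc m then 1 else 0))"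
    by (intro sum.cong) (auto simp: div_Suc dvd_eq_mod_eq_0)
  also have "\<dots> = multiplicity p (fact m :: nat) + card {j\<in>{1..N}. p ^ j dvd Suc m}"
    using Suc by (simp add: sum.distrib sum.If_cases Int_def)
  also have "{j\<in>{1..N}. p ^ j dvd Suc m} = {1..multiplicity p (Suc m)}"
  proof (rule set_eqI)
    fix j
    have "p ^ j dvd Suc m \<longleftrightarrow> j \<le> multiplicity p (Suc m)"
      using p by (intro power_dvd_iff_le_multiplicity) auto
    then show "j \<in> {j\<in>{1..N}. p ^ j dvd Suc m} \<longleftrightarrow> j \<in> {1..multiplicity p (Suc m)}"
      using mult unfolding mem_Collect_eq atLeastAtMost_iff by linarith
  qed
  also have "multiplicity p (fact m :: nat) + card {1..multiplicity p (Suc m)}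
      = multiplicity p (fact (Suc m) :: nat)"
    using assms(1) prime_elem_multiplicity_mult_distrib[of p "Suc m" "fact m"]
    by (simp only: fact_Suc of_nat_id card_atLeastAtMost) (simp del: mult_Suc)
  finally show ?case by simp
qed

text \<open>By Legendre's formula each \<open>j\<close> contributes
  \<open>2 * n div p ^ j - 2 * (n div p ^ j)\<close>, which is 1 if doubling
  \<open>n mod p ^ j\<close> produces a carry and 0 otherwise.\<close>

lemma multiplicity_central_binomial:
  fixes p n :: nat
  assumes "prime p"
  shows "multiplicity p ((2 * n) choose n) = card {j. 0 < j \<and> p ^ j \<le> 2 * (n mod p ^ j)}"
proof -
  have p: "p > 1" using assms prime_gt_1_nat by blast
  have carry: "2 * n div d = 2 * (n div d) + (if d \<le> 2 * (n mod d) then 1 else 0)" if "d > 0" for d :: nat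
  proof -
    have "2 * n = d * (2 * (n div d)) + 2 * (n mod d)"
      by (metis add_mult_distrib2 mult.left_commute mult_div_mod_eq)
    then have "2 * n div d = 2 * (n div d) + 2 * (n mod d) div d"
      using that by simp
    moreover have "2 * (n mod d) div d = (if d \<le> 2 * (n mod d) then 1 else 0)"
      using that mod_less_divisor[OF that, of n] by (auto intro!: div_nat_eqI)
    ultimately show ?thesis by simp
  qed
  have "fact n * fact n * ((2 * n) choose n) = (fact (2 * n) :: nat)"
    using binomial_fact_lemma[of n "2 * n"] by simp
  then have "multiplicity p (fact (2 * n) :: nat)
      = 2 * multiplicity p (fact n :: nat) + multiplicity p ((2 * n) choose n)"
    using assms by (metis (no_types, lifting) binomial_eq_0_iff fact_nonzero mult_2 mult_is_0 not_less
        le_add2 prime_elem_multiplicity_mult_distrib prime_imp_prime_elem)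
  moreover have "multiplicity p (fact (2 * n) :: nat)
      = 2 * multiplicity p (fact n :: nat) + card {j\<in>{1..2*n}. p ^ j \<le> 2 * (n mod p ^ j)}"
    using p by (simp add: multiplicity_fact_eq_sum_div[OF assms, where N = "2 * n"] carry sum.distrib
        sum_distrib_left sum.If_cases Int_def)
  moreover have "{j\<in>{1..2*n}. p ^ j \<le> 2 * (n mod p ^ j)} = {j. 0 < j \<and> p ^ j \<le> 2 * (n mod p ^ j)}"
  proof -
    have "j \<le> 2 * n" if "p ^ j \<le> 2 * (n mod p ^ j)" for j
    proof -
      have "j < p ^ j" using power_gt_expt[of p j] p by simp
      also note that
      also have "2 * (n mod p ^ j) \<le> 2 * n" by simp
      finally show ?thesis by simp
    qed
    then show ?thesis by (auto simp: Suc_le_eq)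
  qed
  ultimately show ?thesis by simp
qed

section \<open>Lacunary moduli\<close>

text \<open>Induction on the largest modulus \<open>Q\<close>: start at a multiple \<open>b\<close>
  of \<open>Q\<close> and treat the other moduli, all at most \<open>Q div 5\<close>, from there.
  The resulting \<open>n\<close> exceeds \<open>b\<close> by at most \<open>2 * (Q div 5)\<close>,
  less than half of \<open>Q\<close>, so its residue modulo \<open>Q\<close> is small as
  well.\<close>

lemma lacunary_simultaneous_small_residues:
  fixes S :: "nat set" and a L :: nat
  assumes "finite S" "\<And>x. x \<in> S \<Longrightarrow> 0 < x \<and> x \<le> L"
    and "\<And>x y. \<lbrakk>x \<in> S; y \<in> S; x < y\<rbrakk> \<Longrightarrow> 5 * x \<le> y"
  shows "\<exists>n. a \<le> n \<and> n \<le> a + 2 * L \<and> (\<forall>x\<in>S. 2 * (n mod x) < x)"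
  using assms
proof (induction S arbitrary: a L rule: finite_linorder_max_induct)
  case empty
  then show ?case by auto
next
  case (insert Q S)
  have Q: "0 < Q" "Q \<le> L" using insert.prems by auto
  \<comment> \<open>The least multiple of \<open>Q\<close> that is at least
    \<open>a\<close>.\<close>
  define b where "b = Q * ((a + Q - 1) div Q)"
  have "(a + Q - 1) mod Q + b = a + Q - 1" "(a + Q - 1) mod Q < Q"
    using Q by (auto simp: b_def)
  then have b: "a \<le> b" "b < a + Q" using Q by linarith+
  have "\<exists>n. b \<le> n \<and> n \<le> b + 2 * (Q div 5) \<and> (\<forall>x\<in>S. 2 * (n mod x) < x)"
  proof (rule insert.IH)
    fix x assume "x \<in> S"
    then have "5 * x \<le> Q" using insert by auto
    then show "0 < x \<and> x \<le> Q div 5" using insert.prems \<open>x \<in> S\<close> by auto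
  qed (use insert.prems in auto)
  then obtain n where n: "b \<le> n" "n \<le> b + 2 * (Q div 5)" "\<forall>x\<in>S. 2 * (n mod x) < x"
    by blast
  have "n = b + (n - b)" "n - b < Q" using n Q by auto
  then have "n mod Q = n - b"
    unfolding b_def by (metis mod_less mod_mult_self4 mult.commute)
  then have "2 * (n mod Q) < Q" using n Q by auto
  then show ?case using n b Q by (intro exI[of _ n]) auto
qed

section \<open>Close powers of two primes\<close>

text \<open>A rational ratio would equate a positive power of \<open>p\<close> with a power of
  \<open>q\<close>, against unique factorization.\<close>

lemma ln_prime_ratio_irrational:
  fixes p q :: nat
  assumes "prime p" "prime q" "p \<noteq> q"
  shows "ln (real p) / ln (real q) \<notin> \<rat>"
proof
  assume "ln (real p) / ln (real q) \<in> \<rat>"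
  moreover have pq: "p > 1" "q > 1" using assms prime_gt_1_nat by auto
  ultimately obtain a b where ab: "b \<noteq> 0" "\<bar>ln (real p) / ln (real q)\<bar> = real a / real b"
    by (metis Rats_abs_nat_div_natE)
  have "real b * ln (real p) = real a * ln (real q)"
    using ab pq by (auto simp: field_simps)
  then have "ln (real p ^ b) = ln (real q ^ a)"
    using pq by (simp add: ln_realpow)
  then have "real p ^ b = real q ^ a"
    using pq by simp
  then have "p ^ b = q ^ a"
    by (metis of_nat_eq_iff of_nat_power)
  then have "p dvd q ^ a" using ab by (metis dvd_power gr0I)
  then show False
    using assms by (metis prime_dvd_power primes_dvd_imp_eq)
qed

text \<open>The factor 5 is the gap ratio that \<open>lacunary_simultaneous_small_residues\<close>
  demands of its moduli.\<close>

definition close_powers :: "nat \<Rightarrow> nat \<Rightarrow> nat set" where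
  "close_powers p q = {j. \<exists>j'. p ^ j < 5 * q ^ j' \<and> q ^ j' < 5 * p ^ j}"

text \<open>Logarithms turn closeness up to a factor 5 into a distance below \<open>ln 5\<close>;
  dividing by \<open>ln q\<close> gives a window around the integers that shrinks as
  \<open>q\<close> grows.\<close>

lemma close_powers_near_int:
  assumes "j \<in> close_powers p q" "p > 1" "q > 1"
  shows "\<exists>z::int. \<bar>real j * (ln (real p) / ln (real q)) - of_int z\<bar> < ln 5 / ln (real q)"
proof -
  obtain j' where j': "p ^ j < 5 * q ^ j'" "q ^ j' < 5 * p ^ j"
    using assms(1) by (auto simp: close_powers_def)
  have *: "real j1 * ln (real x) < ln 5 + real j2 * ln (real y)"
    if "x ^ j1 < 5 * y ^ j2" "x > 1" "y > 1" for x y j1 j2 :: nat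
  proof -
    have "real x ^ j1 < 5 * real y ^ j2"
      using that(1) of_nat_less_iff[of "x ^ j1" "5 * y ^ j2", where 'a = real] by simp
    then have "ln (real x ^ j1) < ln (5 * real y ^ j2)"
      using that by (subst ln_less_cancel_iff) auto
    then show ?thesis using that by (simp add: ln_mult ln_realpow)
  qed
  have "\<bar>real j * ln (real p) - real j' * ln (real q)\<bar> < ln 5"
    using *[OF j'(1)] *[OF j'(2)] assms by auto
  moreover have q: "ln (real q) > 0" using assms by simp
  moreover have "real j * (ln (real p) / ln (real q)) - of_int (int j')
      = (real j * ln (real p) - real j' * ln (real q)) / ln (real q)"
    using q by (simp add: field_simps)
  ultimately have "\<bar>real j * (ln (real p) / ln (real q)) - of_int (int j')\<bar> < ln 5 / ln (real q)"
    by (simp add: divide_strict_right_mono)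
  then show ?thesis by blast
qed

text \<open>
  The shifts \<open>k m\<close> are chosen so that the fractional parts of \<open>k m * ln p / ln q\<close> are roughly
  equally spaced; then the \<open>M\<close> translates of the set of close exponents by the \<open>k m\<close> are disjoint.
\<close>
lemma close_powers_density:
  fixes p q M :: nat
  assumes "prime p" "prime q" "p \<noteq> q" "M > 0" "q \<ge> 5 ^ (4 * M)"
  shows "\<exists>K. \<forall>J. M * card (close_powers p q \<inter> {1..J}) \<le> J + K"
proof -
  define \<theta> where "\<theta> = ln (real p) / ln (real q)"
  have irr: "\<theta> \<notin> \<rat>" unfolding \<theta>_def using assms by (intro ln_prime_ratio_irrational)
  have pq: "p > 1" "q > 1" using assms prime_gt_1_nat by auto
  \<comment> \<open>Kronecker: multiples of an irrational are dense modulo 1.\<close>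
  have "\<exists>k. \<bar>frac (real k * \<theta>) - real m / real M\<bar> < 1 / (4 * real M)" if m: "m < M" for m
  proof -
    obtain k where "\<bar>frac (real k * \<theta>) - real m / real M\<bar> < 1 / (4 * real M)"
      by (rule Kronecker_approx_1_explicit[OF irr, of "real m / real M" "1 / (4 * real M)"])
        (use m assms in auto)
    then show ?thesis by blast
  qed
  then obtain k where k: "\<And>m. m < M \<Longrightarrow> \<bar>frac (real (k m) * \<theta>) - real m / real M\<bar> < 1 / (4 * real M)"
    by metis
  define K where "K = (\<Sum>m<M. k m)"
  have kK: "k m \<le> K" if "m < M" for m
    unfolding K_def using that by (intro member_le_sum) auto
  \<comment> \<open>The size of \<open>q\<close> enters here: two windows together cost at most
    \<open>1 / (2 * M)\<close>.\<close>
  have \<delta>: "2 * (ln 5 / ln (real q)) \<le> 1 / (2 * real M)"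
  proof -
    have "real (4 * M) * ln 5 = ln (5 ^ (4 * M))" by (simp add: ln_realpow)
    also have "\<dots> \<le> ln (real q)"
      using assms(5) of_nat_le_iff[of "5 ^ (4 * M)" q, where 'a = real] pq by simp
    finally show ?thesis using assms(4) pq by (simp add: field_simps)
  qed
  have inj: "m = m'" if jm: "j \<in> close_powers p q" "j' \<in> close_powers p q" "m < M" "m' < M"
    "j + k m = j' + k m'" for j j' m m'
  proof (rule ccontr)
    assume "m \<noteq> m'"
    obtain z z' :: int where z: "\<bar>real j * \<theta> - of_int z\<bar> < ln 5 / ln (real q)"
      "\<bar>real j' * \<theta> - of_int z'\<bar> < ln 5 / ln (real q)"
      using close_powers_near_int[OF jm(1) pq] close_powers_near_int[OF jm(2) pq]
      unfolding \<theta>_def by metis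
    \<comment> \<open>A collision puts the two fractional parts within \<open>1 / (2 * M)\<close> of
      differing by the integer \<open>w\<close>. The Kronecker errors add another
      \<open>1 / (2 * M)\<close>, so the integer \<open>m - m' - w * M\<close> has absolute value
      below 1 and vanishes; then \<open>w = 0\<close> since \<open>m\<close> and \<open>m'\<close>
      are below \<open>M\<close>.\<close>
    define w where "w = z' - z - \<lfloor>real (k m) * \<theta>\<rfloor> + \<lfloor>real (k m') * \<theta>\<rfloor>"
    have "real j * \<theta> + real (k m) * \<theta> = real j' * \<theta> + real (k m') * \<theta>"
      using jm(5) by (metis distrib_right of_nat_add)
    then have "\<bar>frac (real (k m) * \<theta>) - frac (real (k m') * \<theta>) - of_int w\<bar> < 1 / (2 * real M)"
      using z \<delta> by (simp add: frac_def w_def)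
    then have "\<bar>real m / real M - real m' / real M - of_int w\<bar> < 1 / (2 * real M) + 2 * (1 / (4 * real M))"
      using k[OF jm(3)] k[OF jm(4)] by linarith
    also have "\<dots> = 1 / real M" by (simp add: field_simps)
    finally have "\<bar>real m / real M - real m' / real M - of_int w\<bar> * real M < 1"
      using assms(4) by (simp add: field_simps)
    moreover have "\<bar>real m / real M - real m' / real M - of_int w\<bar> * real M
        = \<bar>(real m / real M - real m' / real M - of_int w) * real M\<bar>"
      by (simp add: abs_mult)
    moreover have "(real m / real M - real m' / real M - of_int w) * real M
        = of_int (int m - int m' - w * int M)"
      using assms(4) by (simp add: field_simps)
    ultimately have "\<bar>real_of_int (int m - int m' - w * int M)\<bar> < 1"
      by argo
    then have eq: "int m - int m' = w * int M" by linarith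
    have "\<bar>int m - int m'\<bar> < int M" using jm by linarith
    then have "\<bar>w\<bar> * int M < 1 * int M" unfolding eq by (simp add: abs_mult)
    then have "w = 0" unfolding mult_less_cancel_right by linarith
    then show False using eq \<open>m \<noteq> m'\<close> by simp
  qed
  have "M * card (close_powers p q \<inter> {1..J}) \<le> J + K" for J
  proof -
    let ?A = "close_powers p q \<inter> {1..J}"
    have "inj_on (\<lambda>(m, j). j + k m) ({..<M} \<times> ?A)"
      using inj by (fastforce simp: inj_on_def)
    moreover have "(\<lambda>(m, j). j + k m) ` ({..<M} \<times> ?A) \<subseteq> {1..J + K}"
      by (auto intro!: add_le_mono kK)
    ultimately have "card ({..<M} \<times> ?A) \<le> card {1..J + K}"
      by (intro card_inj_on_le) auto
    then show ?thesis by (simp add: card_cartesian_product)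
  qed
  then show ?thesis by blast
qed

section \<open>Combining the pairwise density bounds with the choice of small residues\<close>

theorem theorem1:
  fixes r :: nat and \<epsilon> :: real
  assumes "r \<ge> 1" and "0 < \<epsilon>" and "\<epsilon> < 1 / (20 * (real r)^2)"
  shows "\<exists>c\<^sub>0 :: real. \<forall>p :: nat \<Rightarrow> nat.
           (\<forall>i\<in>{1..r}. prime (p i) \<and> real (p i) \<ge> c\<^sub>0) \<and> inj_on p {1..r} \<longrightarrow>
           infinite {n :: nat. n > 0 \<and>
             (\<forall>i\<in>{1..r}. real (multiplicity (p i) ((2 * n) choose n))
                            \<le> \<epsilon> * ln (real n) / ln (real (p i)))}"
proof -
  \<comment> \<open>With \<open>r / M\<close> at most \<open>\<epsilon> / 2\<close>, the density of
    discarded exponents uses up half of \<open>\<epsilon>\<close>; the other half absorbs additive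
    constants.\<close>
  define M where "M = nat \<lceil>2 * real r / \<epsilon>\<rceil> + 1"
  have M: "real r \<le> (\<epsilon> / 2) * real M" "M > 0"
  proof -
    have "2 * real r / \<epsilon> \<le> real M" unfolding M_def by linarith
    then show "real r \<le> (\<epsilon> / 2) * real M" using assms(2) by (simp add: field_simps)
  qed (simp add: M_def)
  show ?thesis
  proof (intro exI[of _ "real (5 ^ (4 * M))"] allI impI, elim conjE)
    fix p :: "nat \<Rightarrow> nat"
    assume p: "\<forall>i\<in>{1..r}. prime (p i) \<and> real (p i) \<ge> real (5 ^ (4 * M))"
      and inj: "inj_on p {1..r}"
    have pr: "prime (p i)" and big: "p i \<ge> 5 ^ (4 * M)" if "i \<in> {1..r}" for i
      using p that of_nat_le_iff by blast+
    \<comment> \<open>The bound 6 makes consecutive powers of one prime lacunary and later gives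
      \<open>6 * p i ^ Suc J \<le> p i ^ Suc (Suc J)\<close>.\<close>
    have six: "p i \<ge> 6" if "i \<in> {1..r}" for i
    proof -
      have "(6::nat) \<le> 5 ^ 4" by simp
      also have "\<dots> \<le> 5 ^ (4 * M)" using M(2) by (intro power_increasing) auto
      finally show ?thesis using big[OF that] by linarith
    qed
    have "\<exists>K. \<forall>J. M * card (close_powers (p i) (p i') \<inter> {1..J}) \<le> J + K"
      if "i \<in> {1..r}" "i' \<in> {1..r} - {i}" for i i'
    proof (rule close_powers_density)
      show "p i \<noteq> p i'" using that inj by (auto dest: inj_onD)
    qed (use that pr big M(2) in auto)
    then obtain K where K: "\<And>i i' J. \<lbrakk>i \<in> {1..r}; i' \<in> {1..r} - {i}\<rbrakk>
        \<Longrightarrow> M * card (close_powers (p i) (p i') \<inter> {1..J}) \<le> J + K i i'"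
      by metis
    define C where "C = (\<Sum>i\<in>{1..r}. \<Sum>i'\<in>{1..r} - {i}. K i i')"
    define bad where "bad i = (\<Union>i'\<in>{1..r} - {i}. close_powers (p i) (p i'))" for i
    have bad: "M * card (bad i \<inter> {1..J}) \<le> r * J + C" if i: "i \<in> {1..r}" for i J
    proof -
      have "card (bad i \<inter> {1..J}) \<le> (\<Sum>i'\<in>{1..r} - {i}. card (close_powers (p i) (p i') \<inter> {1..J}))"
        unfolding bad_def Int_UN_distrib2 UN_simps(4)[symmetric] by (intro card_UN_le) auto
      then have "M * card (bad i \<inter> {1..J})
          \<le> M * (\<Sum>i'\<in>{1..r} - {i}. card (close_powers (p i) (p i') \<inter> {1..J}))"
        by simp
      also have "\<dots> \<le> (\<Sum>i'\<in>{1..r} - {i}. J + K i i')"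
        unfolding sum_distrib_left using K i by (intro sum_mono) auto
      also have "\<dots> = (r - 1) * J + (\<Sum>i'\<in>{1..r} - {i}. K i i')"
        using i by (simp add: sum.distrib)
      also have "(\<Sum>i'\<in>{1..r} - {i}. K i i') \<le> C"
        unfolding C_def using i by (intro member_le_sum[of i _ "\<lambda>i. \<Sum>i'\<in>{1..r} - {i}. K i i'"]) auto
      finally show ?thesis by (simp add: diff_mult_distrib)
    qed
    show "infinite {n :: nat. n > 0 \<and>
             (\<forall>i\<in>{1..r}. real (multiplicity (p i) ((2 * n) choose n))
                            \<le> \<epsilon> * ln (real n) / ln (real (p i)))}"
      unfolding infinite_nat_iff_unbounded_le
    proof
      fix L\<^sub>0 :: nat
      \<comment> \<open>Large enough that \<open>\<epsilon> / 2 * ln L / ln (p i)\<close> covers the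
        constant \<open>C + 1\<close> for every \<open>i\<close>; the sum stands in for a
        maximum.\<close>
      define H where "H = (real C + 1) * (2 / \<epsilon>) * (\<Sum>i\<in>{1..r}. ln (real (p i)))"
      define L where "L = nat \<lceil>exp H\<rceil> + L\<^sub>0 + 1"
      have L: "L \<ge> L\<^sub>0" "L \<ge> 1" "exp H \<le> real L" unfolding L_def by linarith+
      have lnp: "ln (real (p i)) > 0" if "i \<in> {1..r}" for i
        using six[OF that] by simp
      have H: "(real C + 1) * (2 / \<epsilon>) * ln (real (p i)) \<le> ln (real L)" if "i \<in> {1..r}" for i
      proof -
        have "ln (real (p i)) \<le> (\<Sum>i\<in>{1..r}. ln (real (p i)))"
          using that lnp by (intro member_le_sum) (auto intro: less_imp_le)
        then have "(real C + 1) * (2 / \<epsilon>) * ln (real (p i)) \<le> H"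
          unfolding H_def using assms(2) by (intro mult_left_mono) auto
        also have "H \<le> ln (real L)" using L by (simp add: ln_ge_iff)
        finally show ?thesis .
      qed
      define S where "S = (\<Union>i\<in>{1..r}. {p i ^ j | j. 0 < j \<and> p i ^ j \<le> L \<and> j \<notin> bad i})"
      have "\<exists>n. L \<le> n \<and> n \<le> L + 2 * L \<and> (\<forall>x\<in>S. 2 * (n mod x) < x)"
      proof (rule lacunary_simultaneous_small_residues)
        show "finite S" by (rule finite_subset[of _ "{..L}"]) (auto simp: S_def)
        show "0 < x \<and> x \<le> L" if "x \<in> S" for x
          using that six by (fastforce simp: S_def)
        fix x y assume "x \<in> S" "y \<in> S" "x < y"
        then obtain i j i' j' where
          ij: "i \<in> {1..r}" "x = p i ^ j" "j \<notin> bad i" "i' \<in> {1..r}" "y = p i' ^ j'"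
          unfolding S_def by blast
        show "5 * x \<le> y"
        proof (cases "i = i'")
          case True
          have "j < j'"
            using \<open>x < y\<close> ij True six[OF ij(1)] by (simp add: power_strict_increasing_iff)
          then have "p i ^ Suc j \<le> y"
            using ij True six[OF ij(1)] by (simp only: ij) (intro power_increasing; simp)
          moreover have "5 * x \<le> p i ^ Suc j"
            using ij six[OF ij(1)] by simp
          ultimately show ?thesis by linarith
        next
          case False
          then have "j \<notin> close_powers (p i) (p i')" using ij by (auto simp: bad_def)
          then have "\<not> (x < 5 * y \<and> y < 5 * x)" using ij unfolding close_powers_def by blast
          then show ?thesis using \<open>x < y\<close> by linarith
        qed
      qed
      then obtain n where n: "L \<le> n" "n \<le> 3 * L" "\<And>x. x \<in> S \<Longrightarrow> 2 * (n mod x) < x" by auto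
      have "real (multiplicity (p i) ((2 * n) choose n)) \<le> \<epsilon> * ln (real n) / ln (real (p i))"
        if i: "i \<in> {1..r}" for i
      proof -
        obtain J where J: "p i ^ J \<le> L" "L < p i ^ Suc J"
          using ex_power_ivl1[of "p i" L] six[OF i] L by auto
        let ?A = "{j. 0 < j \<and> p i ^ j \<le> 2 * (n mod p i ^ j)}"
        \<comment> \<open>Carries at \<open>j \<le> J\<close> occur only for bad \<open>j\<close>,
          as the other powers lie in \<open>S\<close>. Exponents from \<open>J + 2\<close> on are
          excluded by \<open>2 * n \<le> 6 * L < p i ^ (J + 2)\<close>. The power at
          \<open>J + 1\<close> exceeds \<open>L\<close>, so it is uncontrolled and counted as one
          extra carry.\<close>
        have "?A \<subseteq> insert (Suc J) (bad i \<inter> {1..J})"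
        proof
          fix j assume "j \<in> ?A"
          then have j: "0 < j" "p i ^ j \<le> 2 * (n mod p i ^ j)" by auto
          have "p i ^ j \<le> 2 * n" using j(2) mod_less_eq_dividend[of n "p i ^ j"] by linarith
          also have "\<dots> < 6 * p i ^ Suc J" using n J by simp
          also have "\<dots> \<le> p i ^ Suc (Suc J)" using six[OF i] by simp
          finally have "j < Suc (Suc J)" using six[OF i] by (subst (asm) power_strict_increasing_iff) auto
          moreover have "j \<in> bad i" if "j \<le> J"
          proof (rule ccontr)
            assume "j \<notin> bad i"
            have "p i ^ j \<le> p i ^ J" using that six[OF i] by (intro power_increasing) auto
            then have "p i ^ j \<le> L" using J by simp
            then have "p i ^ j \<in> S" using \<open>j \<notin> bad i\<close> j i unfolding S_def by blast
            then show False using n(3) j(2) by fastforce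
          qed
          ultimately show "j \<in> insert (Suc J) (bad i \<inter> {1..J})" using j by auto
        qed
        then have "card ?A \<le> card (insert (Suc J) (bad i \<inter> {1..J}))"
          by (intro card_mono) auto
        then have card: "card ?A \<le> card (bad i \<inter> {1..J}) + 1" by simp
        have ln_mono: "ln (real L) \<le> ln (real n)" using n L by simp
        have "real J * ln (real (p i)) = ln (real (p i ^ J))" using six[OF i] by (simp add: ln_realpow)
        also have "\<dots> \<le> ln (real L)" using J six[OF i] L by (subst ln_le_cancel_iff) auto
        finally have Jle: "real J \<le> ln (real n) / ln (real (p i))"
          using lnp[OF i] ln_mono by (simp add: field_simps)
        have "real M * real (card (bad i \<inter> {1..J})) \<le> real r * real J + real C"
          using bad[OF i, of J] by (metis of_nat_add of_nat_le_iff of_nat_mult)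
        \<comment> \<open>Enlarging \<open>C\<close> to \<open>M * C\<close> allows cancelling
          \<open>M\<close>.\<close>
        also have "\<dots> \<le> (\<epsilon> / 2) * real M * real J + real M * real C"
          using M mult_right_mono[of 1 "real M" "real C"] by (intro add_mono mult_right_mono) auto
        also have "\<dots> = real M * ((\<epsilon> / 2) * real J + real C)" by (simp add: algebra_simps)
        finally have "real (card (bad i \<inter> {1..J})) \<le> (\<epsilon> / 2) * real J + real C"
          using M(2) by simp
        also have "(\<epsilon> / 2) * real J \<le> (\<epsilon> / 2) * (ln (real n) / ln (real (p i)))"
          using Jle assms(2) by (intro mult_left_mono) auto
        finally have "real (card ?A) \<le> (\<epsilon> / 2) * (ln (real n) / ln (real (p i))) + (real C + 1)"
          using card by linarith
        also have "real C + 1 \<le> (\<epsilon> / 2) * (ln (real n) / ln (real (p i)))"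
        proof -
          have "(real C + 1) * (2 / \<epsilon>) * ln (real (p i)) \<le> ln (real n)"
            using H[OF i] ln_mono by linarith
          then show ?thesis using lnp[OF i] assms(2) by (simp add: field_simps)
        qed
        finally show ?thesis
          unfolding multiplicity_central_binomial[OF pr[OF i]] by (simp add: field_simps)
      qed
      then show "\<exists>n\<ge>L\<^sub>0. n \<in> {n :: nat. n > 0 \<and>
             (\<forall>i\<in>{1..r}. real (multiplicity (p i) ((2 * n) choose n))
                            \<le> \<epsilon> * ln (real n) / ln (real (p i)))}"
        using n L by (intro exI[of _ n]) auto
    qed
  qed
qed

end
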